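(* Let $T$ be a tree and suppose that $(u_n)_{n\in\mathbb{N}}$ is a sequence of distinct vertices of $T$. Let $H$ be the convex hull of $\{u_n : n\in\mathbb{N}\}$ in $T$. The following conditions are equivalent: (i) $H$ is almost a ray. (ii) For every non-degenerate labeling $l\colon V(T)\to\mathbb{R}^{+}$, the existence of a subsequence of $(u_n)_{n\in\mathbb{N}}$ that is Cauchy in $(V(T),d_l)$ implies that $(u_n)_{n\in\mathbb{N}}$ itself is a Cauchy sequence in $(V(T),d_l)$.
   Context: All graphs are simple (undirected, with nonempty vertex set, no loops or multiple edges) and may be finite or infinite, of arbitrary cardinality. $V(G)$ and $E(G)$ denote the vertex and edge sets of a graph $G$; $H\subseteq G$ means that $H$ is a subgraph of $G$, and the union of subgraphs has as vertex set (edge set) the union of the vertex sets (edge sets). A tree is a connected graph without cycles. $\mathbb{R}^{+}=[0,\infty)$ and $\mathbb{N}=\{1,2,\dots\}$. A labeling $l\colon V(T)\to\mathbb{R}^{+}$ of a tree $T$ is non-degenerate if $\max\{l(u),l(v)\}>0$ for every edge $\{u,v\}$ of $T$. For a labeling $l$, the function $d_l\colon V(T)\times V(T)\to\mathbb{R}^{+}$ is defined by $d_l(u,u)=0$ and, for $u\ne v$, $d_l(u,v)=\max_{w\in V(P)} l(w)$, where $P$ is the unique path joining $u$ and $v$ in $T$ (endpoints included). When $l$ is non-degenerate, $d_l$ is an ultrametric on $V(T)$. For a nonempty set $A\subseteq V(T)$, the convex hull of $A$ is the subtree $H_A$ of $T$ such that $A\subseteq V(H_A)$ and $H_A$ is a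 subtree of every subtree $T^{*}$ of $T$ with $A\subseteq V(T^{*})$ (it exists and is unique). A ray is an infinite graph $R$ with $V(R)=\{v_1,v_2,\dots,v_n,\dots\}$ (the $v_i$ pairwise distinct) and $E(R)=\{\{v_1,v_2\},\{v_2,v_3\},\dots,\{v_n,v_{n+1}\},\dots\}$. An infinite tree $T$ is almost a ray if there are a ray $R\subseteq T$ and a finite tree $T_0\subseteq T$ such that $T=T_0\cup R$. *)

theory Defs
  imports "HOL-Analysis.Abstract_Metric_Spaces"
begin

text \<open>Simple undirected graphs, finite or infinite; an edge is a two-element set of vertices.\<close>

record 'a ugraph =
  verts :: "'a set"
  edges :: "'a set set"

definition simple_graph :: "'a ugraph \<Rightarrow> bool" where
  "simple_graph G \<longleftrightarrow> verts G \<noteq> {} \<and>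
     (\<forall>e \<in> edges G. \<exists>x \<in> verts G. \<exists>y \<in> verts G. x \<noteq> y \<and> e = {x, y})"

definition subgraph :: "'a ugraph \<Rightarrow> 'a ugraph \<Rightarrow> bool" where
  "subgraph H G \<longleftrightarrow> simple_graph H \<and> verts H \<subseteq> verts G \<and> edges H \<subseteq> edges G"

definition graph_union :: "'a ugraph \<Rightarrow> 'a ugraph \<Rightarrow> 'a ugraph" where
  "graph_union G H = \<lparr>verts = verts G \<union> verts H, edges = edges G \<union> edges H\<rparr>"

definition path_graph :: "'a list \<Rightarrow> 'a ugraph" where
  "path_graph xs = \<lparr>verts = set xs, edges = {{xs ! i, xs ! Suc i} | i. Suc i < length xs}\<rparr>"

text \<open>The one-vertex graph counts as a path joining its vertex to itself.\<close>

definition path_joining :: "'a \<Rightarrow> 'a \<Rightarrow> 'a ugraph \<Rightarrow> bool" where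
  "path_joining x y P \<longleftrightarrow>
     (\<exists>xs. xs \<noteq> [] \<and> distinct xs \<and> hd xs = x \<and> last xs = y \<and> P = path_graph xs)"

definition is_cycle :: "'a ugraph \<Rightarrow> bool" where
  "is_cycle C \<longleftrightarrow> (\<exists>xs. length xs \<ge> 3 \<and> distinct xs \<and>
     C = \<lparr>verts = set xs, edges = insert {last xs, hd xs} (edges (path_graph xs))\<rparr>)"

definition connected_graph :: "'a ugraph \<Rightarrow> bool" where
  "connected_graph G \<longleftrightarrow>
     (\<forall>x \<in> verts G. \<forall>y \<in> verts G. \<exists>P. subgraph P G \<and> path_joining x y P)"

definition is_tree :: "'a ugraph \<Rightarrow> bool" where
  "is_tree T \<longleftrightarrow> simple_graph T \<and> connected_graph T \<and> \<not> (\<exists>C. subgraph C T \<and> is_cycle C)"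

definition subtree :: "'a ugraph \<Rightarrow> 'a ugraph \<Rightarrow> bool" where
  "subtree S T \<longleftrightarrow> is_tree S \<and> subgraph S T"

definition tree_path :: "'a ugraph \<Rightarrow> 'a \<Rightarrow> 'a \<Rightarrow> 'a ugraph" where
  "tree_path T x y = (THE P. subgraph P T \<and> path_joining x y P)"

text \<open>Only the values of a labeling on the vertices of the tree are relevant.\<close>

definition nondegenerate_labeling :: "'a ugraph \<Rightarrow> ('a \<Rightarrow> real) \<Rightarrow> bool" where
  "nondegenerate_labeling T l \<longleftrightarrow>
     (\<forall>x \<in> verts T. 0 \<le> l x) \<and>
     (\<forall>x y. {x, y} \<in> edges T \<longrightarrow> max (l x) (l y) > 0)"

text \<open>The value 0 outside the vertex set is a convention: the locale \<open>Metric_space\<close> requires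
  symmetry and nonnegativity of the distance on the whole type.\<close>

definition label_dist :: "'a ugraph \<Rightarrow> ('a \<Rightarrow> real) \<Rightarrow> 'a \<Rightarrow> 'a \<Rightarrow> real" where
  "label_dist T l x y =
     (if x \<in> verts T \<and> y \<in> verts T \<and> x \<noteq> y then Max (l ` verts (tree_path T x y)) else 0)"

definition tree_hull :: "'a ugraph \<Rightarrow> 'a set \<Rightarrow> 'a ugraph" where
  "tree_hull T A = (THE H. subtree H T \<and> A \<subseteq> verts H \<and>
     (\<forall>S. subtree S T \<and> A \<subseteq> verts S \<longrightarrow> subtree H S))"

definition is_ray :: "'a ugraph \<Rightarrow> bool" where
  "is_ray R \<longleftrightarrow> (\<exists>v :: nat \<Rightarrow> 'a. inj v \<and>
     R = \<lparr>verts = range v, edges = range (\<lambda>n. {v n, v (Suc n)})\<rparr>)"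

definition almost_ray :: "'a ugraph \<Rightarrow> bool" where
  "almost_ray T \<longleftrightarrow> is_tree T \<and> infinite (verts T) \<and>
     (\<exists>R T\<^sub>0. is_ray R \<and> subgraph R T \<and> subtree T\<^sub>0 T \<and> finite (verts T\<^sub>0) \<and>
        T = graph_union T\<^sub>0 R)"

end

theory Submission
  imports Defs
begin

text \<open>Write \<open>U\<close> for the set of all \<open>u n\<close>, root \<open>T\<close> at a vertex \<open>p\<close> of \<open>U\<close>, and let \<open>x \<preceq> y\<close> mean
  that \<open>x\<close> lies on the path from \<open>p\<close> to \<open>y\<close>. The convex hull of \<open>U\<close> is then the subgraph induced
  on the vertices that lie below some vertex of \<open>U\<close> (\<open>tree_hull_eq_down_set\<close>).

  If the hull is almost a ray, then all but finitely many \<open>u n\<close> lie on the ray and run out to its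
  end. The paths between members of a Cauchy subsequence cover a tail of the ray, so labels tend to
  \<open>0\<close> along the ray, which makes the whole sequence Cauchy (\<open>MCauchy_along_ray\<close>).

  For the converse a bad labeling is needed. Suppose that a subsequence \<open>a\<close> of \<open>u\<close> with set of
  values \<open>A\<close> is given, and let \<open>K N\<close> be the union of all paths between \<open>a j\<close> and \<open>a k\<close> with
  \<open>j, k \<ge> N\<close>. Label a vertex by \<open>1 / (N + 1)\<close> for the first \<open>N\<close> at which it is outside \<open>K N\<close>, and by
  \<open>0\<close> if it is in every \<open>K N\<close>. This makes \<open>a\<close> Cauchy for free. The vertices outside \<open>K 0\<close> get the
  label \<open>1\<close>, so \<open>u\<close> is not Cauchy as soon as it takes infinitely many values there. An edge from \<open>x\<close>
  up to \<open>y\<close> that is in every \<open>K N\<close> would be crossed by \<open>a\<close> infinitely often, so the labeling is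
  non-degenerate if each vertex has only finitely many, or all but finitely many, members of \<open>A\<close>
  above it (\<open>non_Cauchy_labeling\<close>).

  It remains to find \<open>A\<close> when the hull is not almost a ray. Climb from the root, keeping infinitely
  many vertices of \<open>U\<close> above. If the climb stops at a vertex, infinitely many branches there contain
  vertices of \<open>U\<close>; choose one in each, put infinitely many of them into \<open>A\<close> and leave infinitely many
  out (\<open>splits_at_star\<close>). Otherwise the climb is a ray. If infinitely many vertices of \<open>U\<close> are off
  the ray, then either the vertices of \<open>U\<close> on the ray can serve as \<open>A\<close>, or the branches leaving
  the ray are treated like those at a star (\<open>splits_along_comb\<close>). If only finitely many are off the
  ray, the hull is the ray plus finitely many finite paths (\<open>almost_ray_hull\<close>).\<close>

section \<open>Paths as vertex lists\<close>

definition vertex_path :: "'a ugraph \<Rightarrow> 'a list \<Rightarrow> bool" where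
  "vertex_path G xs \<longleftrightarrow> xs \<noteq> [] \<and> distinct xs \<and> set xs \<subseteq> verts G \<and>
     successively (\<lambda>a b. {a, b} \<in> edges G) xs"

lemma verts_path_graph [simp]: "verts (path_graph xs) = set xs"
  by (simp add: path_graph_def)

lemma edges_path_graph_subset_iff:
  "edges (path_graph xs) \<subseteq> E \<longleftrightarrow> successively (\<lambda>a b. {a, b} \<in> E) xs"
  by (auto simp: path_graph_def successively_conv_nth)

lemma simple_graph_path_graph:
  assumes "xs \<noteq> []" "distinct xs"
  shows "simple_graph (path_graph xs)"
proof -
  have "\<exists>x \<in> set xs. \<exists>y \<in> set xs. x \<noteq> y \<and> {xs ! i, xs ! Suc i} = {x, y}"
    if "Suc i < length xs" for i
    using that assms by (metis Suc_lessD n_not_Suc_n nth_eq_iff_index_eq nth_mem)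
  then show ?thesis
    using assms unfolding simple_graph_def path_graph_def by auto
qed

lemma subgraph_path_graph_iff:
  assumes "xs \<noteq> []" "distinct xs"
  shows "subgraph (path_graph xs) G \<longleftrightarrow> vertex_path G xs"
  using assms simple_graph_path_graph[OF assms] edges_path_graph_subset_iff[of xs "edges G"]
  unfolding subgraph_def vertex_path_def by simp

text \<open>The translation from paths as subgraphs to paths as lists, which are easy to cut, join and
  reverse.\<close>

lemma path_in_graph_iff:
  "subgraph P G \<and> path_joining x y P \<longleftrightarrow>
     (\<exists>xs. vertex_path G xs \<and> hd xs = x \<and> last xs = y \<and> P = path_graph xs)"
  unfolding path_joining_def using subgraph_path_graph_iff
  by (metis vertex_path_def)

lemma vertex_path_rev: "vertex_path G (rev xs) \<longleftrightarrow> vertex_path G xs"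
  by (simp add: vertex_path_def insert_commute)

lemma vertex_path_append_left: "vertex_path G (xs @ z # ys) \<Longrightarrow> vertex_path G (xs @ [z])"
  by (auto simp: vertex_path_def successively_append_iff)

lemma vertex_path_append_right: "vertex_path G (xs @ z # ys) \<Longrightarrow> vertex_path G (z # ys)"
  by (auto simp: vertex_path_def successively_append_iff)

text \<open>Two paths that leave a common vertex along different edges and meet again close up to a
  cycle: follow the first path up to its first vertex \<open>z\<close> on the second path, and return along
  the second path.\<close>

lemma forking_paths_yield_cycle:
  assumes p: "vertex_path G (x # xs)" and q: "vertex_path G (x # ys)"
    and ne: "xs \<noteq> []" "ys \<noteq> []" and fork: "hd xs \<noteq> hd ys" and end_eq: "last xs = last ys"
  shows "\<exists>C. subgraph C G \<and> is_cycle C"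
proof -
  have "\<exists>z \<in> set xs. z \<in> set ys" using ne end_eq by (metis last_in_set)
  then obtain as z as' where xs: "xs = as @ z # as'" and z: "z \<in> set ys"
    and first: "\<forall>a \<in> set as. a \<notin> set ys"
    using split_list_first_prop[of xs "\<lambda>z. z \<in> set ys"] by blast
  obtain bs bs' where ys: "ys = bs @ z # bs'" using z by (meson split_list)
  define c where "c = x # as @ z # rev bs"
  have d: "distinct c" using p q first unfolding c_def xs ys vertex_path_def by auto
  have len: "length c \<ge> 3"
    using fork unfolding c_def xs ys by (cases as; cases bs) auto
  have vs: "set c \<subseteq> verts G" using p q unfolding c_def xs ys vertex_path_def by auto
  let ?S = "successively (\<lambda>a b. {a, b} \<in> edges G)"
  have s1: "?S (x # as @ [z])" using p vertex_path_append_left[of G "x # as" z as']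
    unfolding xs vertex_path_def by simp
  have s2: "?S (x # bs @ [z])" using q vertex_path_append_left[of G "x # bs" z bs']
    unfolding ys vertex_path_def by simp
  have "?S (rev (x # bs @ [z]))"
    using s2 by (simp only: successively_rev) (simp add: insert_commute)
  then have s2': "?S ((z # rev bs) @ [x])" by simp
  then have s3: "?S (z # rev bs)" and close: "{last (z # rev bs), x} \<in> edges G"
    unfolding successively_append_iff by auto
  have "?S ((x # as) @ [z])" using s1 by simp
  then have "?S (x # as)" "{last (x # as), z} \<in> edges G"
    unfolding successively_append_iff by auto
  then have "?S ((x # as) @ (z # rev bs))"
    using s3 unfolding successively_append_iff by auto
  then have "?S c" unfolding c_def by simp
  then have es: "edges (path_graph c) \<subseteq> edges G"
    by (simp add: edges_path_graph_subset_iff)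
  have close': "{last c, hd c} \<in> edges G" using close unfolding c_def by simp
  define C where "C = \<lparr>verts = set c, edges = insert {last c, hd c} (edges (path_graph c))\<rparr>"
  have cyc: "is_cycle C" unfolding is_cycle_def C_def using d len by blast
  have cne: "c \<noteq> []" by (simp add: c_def)
  have "last c \<noteq> hd c" using d len by (cases c) auto
  then have "simple_graph C"
    using simple_graph_path_graph[OF cne d] cne unfolding simple_graph_def C_def
    by simp (metis last_in_set list.set_sel(1))
  then have "subgraph C G" using vs es close' unfolding subgraph_def C_def by simp
  then show ?thesis using cyc by blast
qed

section \<open>Segments of a tree\<close>

abbreviation seg :: "'a ugraph \<Rightarrow> 'a \<Rightarrow> 'a \<Rightarrow> 'a set" where
  "seg T x y \<equiv> verts (tree_path T x y)"

definition induced_graph :: "'a ugraph \<Rightarrow> 'a set \<Rightarrow> 'a ugraph" where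
  "induced_graph G S = \<lparr>verts = S, edges = {e \<in> edges G. e \<subseteq> S}\<rparr>"

locale tree =
  fixes T :: "'a ugraph"
  assumes is_tree: "is_tree T"
begin

abbreviation V :: "'a set" where "V \<equiv> verts T"

text \<open>Strip the common initial part of the two paths. Where they first differ they fork, and since
  they end at the same vertex this would produce a cycle.\<close>

lemma path_unique:
  assumes "vertex_path T xs" "vertex_path T ys" "hd xs = hd ys" "last xs = last ys"
  shows "xs = ys"
  using assms
proof (induction xs arbitrary: ys)
  case Nil
  then show ?case by (simp add: vertex_path_def)
next
  case (Cons x xs)
  obtain ys' where ys: "ys = x # ys'"
    using Cons.prems by (cases ys) (auto simp: vertex_path_def)
  show ?case
  proof (cases "xs = [] \<or> ys' = []")
    case True
    have "last (x # xs) = last (x # ys')" "x \<notin> set xs" "x \<notin> set ys'"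
      using Cons.prems unfolding ys vertex_path_def by simp_all
    then have "xs = ys'"
      using True last_in_set[of xs] last_in_set[of ys'] by (cases "xs = []"; cases "ys' = []") simp_all
    then show ?thesis using ys by simp
  next
    case False
    have fork: "\<not> (hd xs \<noteq> hd ys')"
      using forking_paths_yield_cycle[of T x xs ys'] Cons.prems False is_tree
      unfolding ys is_tree_def by auto
    have "vertex_path T xs" "vertex_path T ys'"
      using Cons.prems False unfolding ys vertex_path_def by (auto simp: successively_Cons)
    then show ?thesis using Cons.IH[of ys'] fork Cons.prems False unfolding ys by simp
  qed
qed

lemma path_exists:
  assumes "x \<in> V" "y \<in> V"
  obtains xs where "vertex_path T xs" "hd xs = x" "last xs = y"
  using assms is_tree path_in_graph_iff unfolding is_tree_def connected_graph_def by metis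

lemma seg_path:
  assumes "vertex_path T xs"
  shows "seg T (hd xs) (last xs) = set xs"
proof -
  have "tree_path T (hd xs) (last xs) = path_graph xs"
    unfolding tree_path_def
  proof (rule the_equality)
    show "subgraph (path_graph xs) T \<and> path_joining (hd xs) (last xs) (path_graph xs)"
      unfolding path_in_graph_iff using assms by blast
    fix P assume "subgraph P T \<and> path_joining (hd xs) (last xs) P"
    then obtain ys where "vertex_path T ys" "hd ys = hd xs" "last ys = last xs" "P = path_graph ys"
      unfolding path_in_graph_iff by blast
    then show "P = path_graph xs" using path_unique[OF _ assms, of ys] by simp
  qed
  then show ?thesis by simp
qed

lemma seg_refl: "x \<in> V \<Longrightarrow> seg T x x = {x}"
  using seg_path[of "[x]"] by (simp add: vertex_path_def)

lemma seg_basic: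
  assumes "x \<in> V" "y \<in> V"
  shows "finite (seg T x y)" "x \<in> seg T x y" "y \<in> seg T x y" "seg T x y \<subseteq> V"
proof -
  obtain xs where xs: "vertex_path T xs" "hd xs = x" "last xs = y"
    using path_exists assms by blast
  then have "seg T x y = set xs" using seg_path by blast
  then show "finite (seg T x y)" "x \<in> seg T x y" "y \<in> seg T x y" "seg T x y \<subseteq> V"
    using xs by (auto simp: vertex_path_def)
qed

lemma seg_commute:
  assumes "x \<in> V" "y \<in> V"
  shows "seg T x y = seg T y x"
proof -
  obtain xs where xs: "vertex_path T xs" "hd xs = x" "last xs = y"
    using path_exists assms by blast
  have "xs \<noteq> []" using xs by (simp add: vertex_path_def)
  then show ?thesis using seg_path[of xs] seg_path[of "rev xs"] xs
    by (simp add: vertex_path_rev hd_rev last_rev)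
qed

lemma seg_split:
  assumes "x \<in> V" "y \<in> V" "z \<in> seg T x y"
  shows "seg T x z \<union> seg T z y = seg T x y" "seg T x z \<inter> seg T z y = {z}"
proof -
  obtain xs where xs: "vertex_path T xs" "hd xs = x" "last xs = y"
    using path_exists assms by blast
  have seg: "seg T x y = set xs" using seg_path xs by blast
  then obtain as bs where s: "xs = as @ z # bs" using assms(3) by (metis split_list)
  have 1: "seg T x z = set (as @ [z])"
    using seg_path[OF vertex_path_append_left[of T as z bs]] xs(1,2) s by (cases as) auto
  have 2: "seg T z y = set (z # bs)"
    using seg_path[OF vertex_path_append_right[of T as z bs]] xs(1,3) s by auto
  show "seg T x z \<union> seg T z y = seg T x y" "seg T x z \<inter> seg T z y = {z}"
    using xs(1) unfolding seg 1 2 s vertex_path_def by auto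
qed

text \<open>Follow the path from \<open>x\<close> to \<open>z\<close> until it first meets the path from \<open>z\<close> to \<open>y\<close>, and
  continue on the latter: this is the path from \<open>x\<close> to \<open>y\<close>.\<close>

lemma seg_triangle:
  assumes "x \<in> V" "y \<in> V" "z \<in> V"
  shows "seg T x y \<subseteq> seg T x z \<union> seg T z y"
proof -
  obtain xs where xs: "vertex_path T xs" "hd xs = x" "last xs = z"
    using path_exists assms by blast
  obtain ys where ys: "vertex_path T ys" "hd ys = z" "last ys = y"
    using path_exists assms by blast
  have "\<exists>m \<in> set xs. m \<in> set ys" using xs ys unfolding vertex_path_def
    by (metis last_in_set list.set_sel(1))
  then obtain as m as' where s: "xs = as @ m # as'" and m: "m \<in> set ys"
    and first: "\<forall>a \<in> set as. a \<notin> set ys"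
    using split_list_first_prop[of xs "\<lambda>m. m \<in> set ys"] by blast
  obtain bs bs' where t: "ys = bs @ m # bs'" using m by (meson split_list)
  have "vertex_path T (as @ m # bs')"
    using xs(1) ys(1) first unfolding s t vertex_path_def
    by (auto simp: successively_append_iff)
  moreover have "hd (as @ m # bs') = x" "last (as @ m # bs') = y"
    using xs ys unfolding s t by (cases as; simp)+
  ultimately have "seg T x y = set (as @ m # bs')" using seg_path by blast
  moreover have "seg T x z = set xs" "seg T z y = set ys"
    using seg_path[OF xs(1)] seg_path[OF ys(1)] xs(2,3) ys(2,3) by simp_all
  ultimately show ?thesis unfolding s t by auto
qed

lemma edge_ends:
  assumes "e \<in> edges T"
  obtains x y where "x \<in> V" "y \<in> V" "x \<noteq> y" "e = {x, y}"
proof -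
  have "simple_graph T" using is_tree unfolding is_tree_def by blast
  then have "\<exists>x \<in> V. \<exists>y \<in> V. x \<noteq> y \<and> e = {x, y}" using assms unfolding simple_graph_def by simp
  then show thesis using that by blast
qed

lemma edge_in_tree:
  assumes "{x, y} \<in> edges T"
  shows "x \<in> V" "y \<in> V" "x \<noteq> y"
  using edge_ends[OF assms] by (metis doubleton_eq_iff)+

lemma edge_iff_seg:
  assumes "x \<in> V" "y \<in> V" "x \<noteq> y"
  shows "{x, y} \<in> edges T \<longleftrightarrow> seg T x y = {x, y}"
proof
  assume "{x, y} \<in> edges T"
  then have "vertex_path T [x, y]" using assms by (simp add: vertex_path_def)
  then show "seg T x y = {x, y}" using seg_path by fastforce
next
  assume s: "seg T x y = {x, y}"
  obtain xs where xs: "vertex_path T xs" "hd xs = x" "last xs = y"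
    using path_exists assms by blast
  have set: "set xs = {x, y}" using seg_path[OF xs(1)] xs s by simp
  have "length xs = 2" using xs(1) distinct_card[of xs] assms(3) unfolding set vertex_path_def by simp
  then have "xs = [x, y]" using xs(2,3) by (auto simp: length_Suc_conv numeral_2_eq_2)
  then show "{x, y} \<in> edges T" using xs(1) by (simp add: vertex_path_def)
qed

text \<open>If \<open>y\<close> is not on the path from \<open>p\<close> to \<open>x\<close>, appending it to that path yields the path from \<open>p\<close>
  to \<open>y\<close>.\<close>

lemma edge_comparable:
  assumes "{x, y} \<in> edges T" "p \<in> V"
  shows "x \<in> seg T p y \<or> y \<in> seg T p x"
proof (rule disjCI)
  assume n: "y \<notin> seg T p x"
  have xy: "x \<in> V" "y \<in> V" using edge_in_tree assms by blast+
  obtain xs where xs: "vertex_path T xs" "hd xs = p" "last xs = x"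
    using path_exists assms xy by blast
  have "y \<notin> set xs" using seg_path[OF xs(1)] n xs by simp
  then have "vertex_path T (xs @ [y])" using xs xy assms
    unfolding vertex_path_def by (auto simp: successively_append_iff)
  moreover have "xs \<noteq> []" using xs by (simp add: vertex_path_def)
  ultimately show "x \<in> seg T p y"
    using seg_path[of "xs @ [y]"] xs by (metis UnCI last_in_set last_snoc hd_append2 set_append)
qed

lemma edge_of_seg:
  assumes "x \<in> V" "y \<in> V" "x \<noteq> y"
  obtains z where "{x, z} \<in> edges T" "z \<in> seg T x y"
proof -
  obtain xs where xs: "vertex_path T xs" "hd xs = x" "last xs = y"
    using path_exists assms by blast
  obtain z zs where s: "xs = x # z # zs"
    using xs assms(3) unfolding vertex_path_def by (cases xs; cases "tl xs") auto
  have "seg T x y = set xs" using seg_path xs by blast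
  then show ?thesis using that[of z] xs(1) unfolding s vertex_path_def by simp
qed

section \<open>Subtrees and convex hulls\<close>

lemma seg_subset_subtree:
  assumes "subtree S T" "x \<in> verts S" "y \<in> verts S"
  shows "seg T x y \<subseteq> verts S"
proof -
  obtain xs where xs: "vertex_path S xs" "hd xs = x" "last xs = y"
    using assms path_in_graph_iff unfolding subtree_def is_tree_def connected_graph_def by metis
  have "vertex_path T xs"
    using xs(1) assms(1) unfolding vertex_path_def subtree_def subgraph_def
    by (auto elim!: successively_mono)
  then have "seg T x y = set xs" using seg_path xs by blast
  then show ?thesis using xs unfolding vertex_path_def by blast
qed

text \<open>A subtree is an induced subgraph: its own path between the ends of an edge of \<open>T\<close> must be that
  edge, since paths in \<open>T\<close> are unique.\<close>

lemma subtree_edge: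
  assumes S: "subtree S T" and e: "{x, y} \<in> edges T" and xy: "x \<in> verts S" "y \<in> verts S"
  shows "{x, y} \<in> edges S"
proof -
  interpret S: tree S using S by unfold_locales (simp add: subtree_def)
  have V: "x \<in> V" "y \<in> V" "x \<noteq> y" using edge_in_tree e by blast+
  obtain xs where xs: "vertex_path S xs" "hd xs = x" "last xs = y"
    using S.path_exists xy by blast
  then have "vertex_path T xs"
    using S unfolding vertex_path_def subtree_def subgraph_def
    by (auto elim!: successively_mono)
  moreover have "vertex_path T [x, y]" using e V by (simp add: vertex_path_def)
  ultimately have "xs = [x, y]" using path_unique xs by fastforce
  then show ?thesis using xs by (simp add: vertex_path_def)
qed

lemma subtree_induced_graph:
  assumes "S \<noteq> {}" "S \<subseteq> V" and convex: "\<And>x y. x \<in> S \<Longrightarrow> y \<in> S \<Longrightarrow> seg T x y \<subseteq> S"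
  shows "subtree (induced_graph T S) T"
proof -
  let ?I = "induced_graph T S"
  have "\<exists>x \<in> S. \<exists>y \<in> S. x \<noteq> y \<and> e = {x, y}" if "e \<in> edges T" "e \<subseteq> S" for e
    using edge_ends[OF that(1)] that(2) by (metis insert_subset)
  then have simple: "simple_graph ?I"
    using assms(1) unfolding simple_graph_def induced_graph_def by simp
  have sub: "subgraph ?I T"
    using assms(2) simple by (auto simp: subgraph_def induced_graph_def)
  have "\<exists>P. subgraph P ?I \<and> path_joining x y P" if xy: "x \<in> S" "y \<in> S" for x y
  proof -
    obtain xs where xs: "vertex_path T xs" "hd xs = x" "last xs = y"
      using path_exists[of x y] xy assms(2) by blast
    have "set xs \<subseteq> S" using convex[OF xy] seg_path[OF xs(1)] xs by simp
    then have "vertex_path ?I xs"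
      using xs(1) unfolding vertex_path_def induced_graph_def
      by (auto elim!: successively_mono)
    then show ?thesis unfolding path_in_graph_iff using xs by blast
  qed
  then have "connected_graph ?I" by (simp add: connected_graph_def induced_graph_def)
  moreover have "\<not> (\<exists>C. subgraph C ?I \<and> is_cycle C)"
    using is_tree sub unfolding is_tree_def subgraph_def by blast
  ultimately show ?thesis using simple sub by (simp add: subtree_def is_tree_def)
qed

end

section \<open>The order of a rooted tree\<close>

locale rooted_tree = tree +
  fixes p :: 'a
  assumes root: "p \<in> V"
begin

abbreviation below :: "'a \<Rightarrow> 'a \<Rightarrow> bool"  (infix "\<preceq>" 50) where
  "x \<preceq> y \<equiv> x \<in> seg T p y"

lemma below_refl: "x \<in> V \<Longrightarrow> x \<preceq> x"
  using seg_basic root by blast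

lemma root_below: "x \<in> V \<Longrightarrow> p \<preceq> x"
  using seg_basic root by blast

lemma below_in_V: "x \<preceq> y \<Longrightarrow> y \<in> V \<Longrightarrow> x \<in> V"
  using seg_basic root by blast

lemma below_trans:
  assumes "x \<preceq> y" "y \<preceq> z" "z \<in> V"
  shows "x \<preceq> z"
  using seg_split(1)[OF root assms(3,2)] assms(1) by blast

lemma below_antisym:
  assumes "x \<preceq> y" "y \<preceq> x" "y \<in> V"
  shows "x = y"
proof -
  have "x \<in> V" using below_in_V assms by blast
  then have "y \<in> seg T x y" using seg_basic assms by blast
  then show ?thesis using seg_split(2)[OF root assms(3,1)] assms(2) by auto
qed

lemma finite_below: "y \<in> V \<Longrightarrow> finite {x. x \<preceq> y}"
  using seg_basic(1)[OF root] by simp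

text \<open>If neither vertex were below the other, each would lie between the other one and \<open>z\<close>, against
  antisymmetry of the order with root \<open>z\<close>.\<close>

lemma below_linear:
  assumes "x \<preceq> z" "y \<preceq> z" "z \<in> V"
  shows "x \<preceq> y \<or> y \<preceq> x"
proof (rule ccontr)
  assume n: "\<not> (x \<preceq> y \<or> y \<preceq> x)"
  have V: "x \<in> V" "y \<in> V" using below_in_V assms by blast+
  have "y \<in> seg T x z" "x \<in> seg T y z"
    using seg_split(1)[OF root assms(3,1)] seg_split(1)[OF root assms(3,2)] assms n by blast+
  then have "y \<in> seg T z x" "x \<in> seg T z y" using seg_commute V assms(3) by blast+
  then have "x = y"
    using rooted_tree.below_antisym[of T z] V assms(3) tree_axioms
    by (simp add: rooted_tree_def rooted_tree_axioms_def)
  then show False using n V below_refl by blast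
qed

lemma below_of_seg:
  assumes "a \<in> V" "b \<in> V" "x \<in> seg T a b"
  shows "x \<preceq> a \<or> x \<preceq> b"
  using seg_triangle[OF assms(1,2) root] seg_commute[OF assms(1) root] assms(3) by blast

text \<open>The vertices above \<open>y\<close> form a convex set: if \<open>y\<close> were not below \<open>x\<close>, it would lie between
  \<open>x\<close> and each end, whereas the two halves of a segment share only the splitting point.\<close>

lemma above_convex:
  assumes V: "a \<in> V" "b \<in> V" and x: "x \<in> seg T a b" and y: "y \<preceq> a" "y \<preceq> b"
  shows "y \<preceq> x"
proof (rule ccontr)
  assume n: "\<not> y \<preceq> x"
  have xV: "x \<in> V" using seg_basic V x by blast
  have "y \<in> seg T x a" "y \<in> seg T x b"
    using seg_triangle[OF root V(1) xV] seg_triangle[OF root V(2) xV] y n by blast+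
  then have "y = x" using seg_split(2)[OF V x] seg_commute[OF xV V(1)] by blast
  then show False using n below_refl xV by blast
qed

definition covers :: "'a \<Rightarrow> 'a \<Rightarrow> bool" where
  "covers c w \<longleftrightarrow> c \<in> V \<and> w \<preceq> c \<and> w \<noteq> c \<and> (\<forall>z. w \<preceq> z \<longrightarrow> z \<preceq> c \<longrightarrow> z = w \<or> z = c)"

lemma cover_exists:
  assumes "w \<preceq> a" "w \<noteq> a" "a \<in> V"
  obtains c where "covers c w" "c \<preceq> a"
proof -
  let ?S = "{z. z \<preceq> a \<and> w \<preceq> z \<and> z \<noteq> w}"
  have fin: "finite ?S" using finite_below[OF assms(3)] by simp
  have "a \<in> ?S" using assms below_refl by blast
  \<comment> \<open>An element of the chain with the fewest predecessors is its minimum.\<close>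
  then obtain c where c: "c \<in> ?S" and min: "\<And>z. z \<in> ?S \<Longrightarrow> card (seg T p c) \<le> card (seg T p z)"
    using ex_has_least_nat[of "\<lambda>z. z \<in> ?S" a "\<lambda>z. card (seg T p z)"] by blast
  have cV: "c \<in> V" using c below_in_V assms by blast
  have "z = w \<or> z = c" if z: "w \<preceq> z" "z \<preceq> c" for z
  proof (rule ccontr)
    assume n: "\<not> (z = w \<or> z = c)"
    have zV: "z \<in> V" using below_in_V z cV by blast
    have "z \<preceq> a" using below_trans z(2) c assms(3) by blast
    then have "card (seg T p c) \<le> card (seg T p z)" using min z n by blast
    moreover have "seg T p z \<subseteq> seg T p c" using below_trans z(2) cV by blast
    ultimately have "seg T p z = seg T p c"
      using finite_below[OF cV] by (simp add: card_seteq)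
    then have "c \<preceq> z" using below_refl cV by blast
    then show False using below_antisym z(2) cV n by blast
  qed
  then have "covers c w" using c cV unfolding covers_def by blast
  then show thesis using that c by blast
qed

lemma cover_unique:
  assumes "covers c w" "covers c' w" "c \<preceq> a" "c' \<preceq> a" "a \<in> V"
  shows "c = c'"
  using below_linear[OF assms(3-5)] assms(1,2) unfolding covers_def by metis

lemma cover_edge:
  assumes "covers c w"
  shows "{w, c} \<in> edges T"
proof -
  have c: "c \<in> V" "w \<preceq> c" "w \<noteq> c" using assms unfolding covers_def by blast+
  have w: "w \<in> V" using below_in_V c by blast
  have "z = w \<or> z = c" if z: "z \<in> seg T w c" for z
    using above_convex[OF w c(1) z below_refl[OF w] c(2)] seg_split(1)[OF root c(1,2)] z assms
    unfolding covers_def by blast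
  then have "seg T w c = {w, c}" using seg_basic[OF w c(1)] by blast
  then show ?thesis using edge_iff_seg c w by blast
qed

lemma edge_cover:
  assumes "{x, y} \<in> edges T" "x \<preceq> y"
  shows "covers y x"
proof -
  have V: "x \<in> V" "y \<in> V" "x \<noteq> y" using edge_in_tree assms by blast+
  have s: "seg T x y = {x, y}" using edge_iff_seg V assms by blast
  have "z = x \<or> z = y" if z: "x \<preceq> z" "z \<preceq> y" for z
    using seg_split(1)[OF root V(2) assms(2)] s z below_antisym[OF _ z(1)] V by blast
  then show ?thesis using V assms unfolding covers_def by blast
qed

definition down_set :: "'a set \<Rightarrow> 'a set" where
  "down_set A = {x. \<exists>a \<in> A. x \<preceq> a}"

lemma subset_down_set: "A \<subseteq> V \<Longrightarrow> A \<subseteq> down_set A"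
  using below_refl unfolding down_set_def by blast

lemma subtree_down_set:
  assumes "A \<subseteq> V" "A \<noteq> {}"
  shows "subtree (induced_graph T (down_set A)) T"
proof (rule subtree_induced_graph)
  show "down_set A \<noteq> {}" using subset_down_set assms by blast
  show sub: "down_set A \<subseteq> V" using below_in_V assms unfolding down_set_def by blast
  show "seg T x y \<subseteq> down_set A" if xy: "x \<in> down_set A" "y \<in> down_set A" for x y
  proof
    fix z assume z: "z \<in> seg T x y"
    obtain a b where ab: "a \<in> A" "x \<preceq> a" "b \<in> A" "y \<preceq> b" using xy unfolding down_set_def by blast
    have "z \<preceq> x \<or> z \<preceq> y" using below_of_seg z xy sub by blast
    then show "z \<in> down_set A" using ab below_trans assms(1) unfolding down_set_def by blast
  qed
qed

text \<open>A subtree that contains \<open>A\<close> contains the path from \<open>p \<in> A\<close> to each member of \<open>A\<close>, hence the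
  down-set; conversely the down-set is already convex.\<close>

lemma tree_hull_eq_down_set:
  assumes "A \<subseteq> V" "p \<in> A"
  shows "tree_hull T A = induced_graph T (down_set A)"
proof -
  let ?D = "induced_graph T (down_set A)"
  have sub: "subtree ?D T" using subtree_down_set assms by blast
  have least: "subtree ?D S" if S: "subtree S T" "A \<subseteq> verts S" for S
  proof -
    have v: "down_set A \<subseteq> verts S"
      using seg_subset_subtree[OF S(1)] S(2) assms(2) unfolding down_set_def by blast
    have "e \<in> edges S" if e: "e \<in> edges T" "e \<subseteq> down_set A" for e
    proof -
      obtain x y where "e = {x, y}" using edge_ends e(1) by metis
      then show ?thesis using subtree_edge[OF S(1), of x y] e v by blast
    qed
    then show ?thesis using sub v unfolding subtree_def subgraph_def
      by (auto simp: induced_graph_def)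
  qed
  have A: "A \<subseteq> verts ?D" using subset_down_set assms by (simp add: induced_graph_def)
  show ?thesis unfolding tree_hull_def
  proof (rule the_equality)
    show "subtree ?D T \<and> A \<subseteq> verts ?D \<and> (\<forall>S. subtree S T \<and> A \<subseteq> verts S \<longrightarrow> subtree ?D S)"
      using sub A least by blast
    fix H assume H: "subtree H T \<and> A \<subseteq> verts H \<and> (\<forall>S. subtree S T \<and> A \<subseteq> verts S \<longrightarrow> subtree H S)"
    then have "subtree H ?D" "subtree ?D H" using sub A least by blast+
    then show "H = ?D" unfolding subtree_def subgraph_def
      by (intro ugraph.equality) auto
  qed
qed

end

section \<open>Distances of a labeling\<close>

context tree
begin

lemma label_dist_less_iff:
  assumes "x \<in> V" "y \<in> V" "e > 0"
  shows "label_dist T l x y < e \<longleftrightarrow> (x \<noteq> y \<longrightarrow> (\<forall>z \<in> seg T x y. l z < e))"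
proof -
  have "finite (l ` seg T x y)" "l ` seg T x y \<noteq> {}"
    using seg_basic[OF assms(1,2)] by auto
  then show ?thesis using assms by (simp add: label_dist_def)
qed

text \<open>Distinct points have positive distance because the path between them contains an edge, one end
  of which has a positive label. For the triangle inequality, the path from \<open>x\<close> to \<open>z\<close> is covered by
  those from \<open>x\<close> to \<open>y\<close> and from \<open>y\<close> to \<open>z\<close>.\<close>

lemma Metric_space_label_dist:
  assumes "nondegenerate_labeling T l"
  shows "Metric_space V (label_dist T l)"
proof
  have l0: "0 \<le> l z" if "z \<in> V" for z
    using assms that unfolding nondegenerate_labeling_def by blast
  have upper: "l z \<le> label_dist T l x y" if "x \<in> V" "y \<in> V" "x \<noteq> y" "z \<in> seg T x y" for x y z
    using that seg_basic[of x y] by (simp add: label_dist_def)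
  show nonneg: "0 \<le> label_dist T l x y" for x y
  proof (cases "x \<in> V \<and> y \<in> V \<and> x \<noteq> y")
    case True
    then show ?thesis using upper[of x y x] l0[of x] seg_basic[of x y] by fastforce
  qed (auto simp: label_dist_def)
  show "label_dist T l x y = label_dist T l y x" for x y
    using seg_commute[of x y] by (auto simp: label_dist_def)
  show "label_dist T l x y = 0 \<longleftrightarrow> x = y" if V: "x \<in> V" "y \<in> V" for x y
  proof
    assume d: "label_dist T l x y = 0"
    show "x = y"
    proof (rule ccontr)
      assume ne: "x \<noteq> y"
      obtain z where z: "{x, z} \<in> edges T" "z \<in> seg T x y" using edge_of_seg V ne by blast
      have "max (l x) (l z) > 0" using assms z(1) unfolding nondegenerate_labeling_def by blast
      then show False using upper[OF V ne z(2)] upper[OF V ne seg_basic(2)[OF V]] d by auto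
    qed
  qed (simp add: label_dist_def)
  show "label_dist T l x z \<le> label_dist T l x y + label_dist T l y z"
    if V: "x \<in> V" "y \<in> V" "z \<in> V" for x y z
  proof (cases "x = y \<or> y = z \<or> x = z")
    case True
    then show ?thesis using nonneg[of x y] nonneg[of y z] by (auto simp: label_dist_def)
  next
    case False
    have "l w \<le> label_dist T l x y + label_dist T l y z" if w: "w \<in> seg T x z" for w
    proof -
      have "w \<in> seg T x y \<or> w \<in> seg T y z" using seg_triangle[OF V(1,3,2)] w by blast
      then show ?thesis
        using upper[of x y w] upper[of y z w] nonneg[of x y] nonneg[of y z] V False by fastforce
    qed
    moreover have "label_dist T l x z = Max (l ` seg T x z)" "finite (l ` seg T x z)"
      "l ` seg T x z \<noteq> {}" using False V seg_basic[of x z] by (auto simp: label_dist_def)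
    ultimately show ?thesis by simp
  qed
qed

lemma MCauchy_label_dist_iff:
  assumes "nondegenerate_labeling T l" "range s \<subseteq> V"
  shows "Metric_space.MCauchy V (label_dist T l) s \<longleftrightarrow>
    (\<forall>e>0. \<exists>N. \<forall>m\<ge>N. \<forall>n\<ge>N. s m \<noteq> s n \<longrightarrow> (\<forall>z \<in> seg T (s m) (s n). l z < e))"
proof -
  have V: "s n \<in> V" for n using assms by blast
  show ?thesis
    using assms(2) label_dist_less_iff[OF V V]
    unfolding Metric_space.MCauchy_def[OF Metric_space_label_dist[OF assms(1)]] by meson
qed

section \<open>Sequences along a ray\<close>

lemma seg_ray:
  assumes "inj v" and edge: "\<And>n. {v n, v (Suc n)} \<in> edges T" and "i \<le> j"
  shows "seg T (v i) (v j) = v ` {i..j}"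
proof -
  let ?xs = "map v [i..<Suc j]"
  have V: "v n \<in> V" for n using edge_in_tree edge by blast
  have "successively (\<lambda>a b. {a, b} \<in> edges T) ?xs"
    using edge by (simp add: successively_conv_nth del: upt_Suc)
  then have "vertex_path T ?xs"
    using V assms(3) inj_on_subset[OF assms(1)] unfolding vertex_path_def
    by (auto simp: distinct_map simp del: upt_Suc)
  moreover have "hd ?xs = v i" "last ?xs = v j" using assms(3)
    by (simp_all add: hd_map last_map del: upt_Suc)
  ultimately have "seg T (v i) (v j) = set ?xs" using seg_path by metis
  then show ?thesis by (simp add: atLeastLessThanSuc_atLeastAtMost del: upt_Suc)
qed

text \<open>A sequence of distinct vertices of which all but finitely many lie on a ray runs out to the
  end of the ray, and so does every subsequence. Hence one Cauchy subsequence already forces the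
  labels to tend to \<open>0\<close> along the ray, and then the whole sequence is Cauchy.\<close>

lemma MCauchy_along_ray:
  assumes l: "nondegenerate_labeling T l" and "inj u" "range u \<subseteq> V"
    and F: "finite F" "range u \<subseteq> F \<union> range v"
    and "inj v" and edge: "\<And>n. {v n, v (Suc n)} \<in> edges T"
    and r: "strict_mono r" and cauchy: "Metric_space.MCauchy V (label_dist T l) (u \<circ> r)"
  shows "Metric_space.MCauchy V (label_dist T l) u"
proof -
  have "finite (u -` F)" using F(1) \<open>inj u\<close> finite_vimageI by blast
  then obtain M where M: "\<And>n. n \<in> u -` F \<Longrightarrow> n < M"
    unfolding finite_nat_set_iff_bounded by blast
  have "\<exists>k. u n = v k" if "n \<ge> M" for n
    using M[of n] that F(2) by fastforce
  then obtain k where k: "\<And>n. n \<ge> M \<Longrightarrow> u n = v (k n)" by metis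
  have escape: "\<exists>B. \<forall>n\<ge>B. n \<ge> M \<and> k n > i" for i
  proof -
    have "finite (u -` (v ` {..i}))" using \<open>inj u\<close> finite_vimageI by blast
    then obtain B where B: "\<And>n. n \<in> u -` (v ` {..i}) \<Longrightarrow> n < B"
      unfolding finite_nat_set_iff_bounded by blast
    have "k n > i" if "n \<ge> max B M" for n
    proof (rule ccontr)
      assume "\<not> k n > i"
      then have "n \<in> u -` (v ` {..i})" using k[of n] that by simp
      then show False using B that by fastforce
    qed
    then show ?thesis by (intro exI[of _ "max B M"]) auto
  qed
  have "\<exists>N. \<forall>m\<ge>N. \<forall>n\<ge>N. u m \<noteq> u n \<longrightarrow> (\<forall>z \<in> seg T (u m) (u n). l z < e)" if e: "e > 0" for e
  proof -
    have "range (u \<circ> r) \<subseteq> V" using assms(3) by auto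
    then obtain N where N: "\<And>m n z. \<lbrakk>m \<ge> N; n \<ge> N; u (r m) \<noteq> u (r n);
        z \<in> seg T (u (r m)) (u (r n))\<rbrakk> \<Longrightarrow> l z < e"
      using cauchy e unfolding MCauchy_label_dist_iff[OF l \<open>range (u \<circ> r) \<subseteq> V\<close>] comp_apply
      by meson
    define N' where "N' = max N M"
    define i\<^sub>0 where "i\<^sub>0 = k (r N')"
    have rN': "r N' \<ge> M" using seq_suble[OF r, of N'] unfolding N'_def by simp
    have small: "l (v i) < e" if i: "i \<ge> i\<^sub>0" for i
    proof -
      \<comment> \<open>A late member of the subsequence lies beyond \<open>v i\<close>, so \<open>v i\<close> is between it and \<open>u (r N')\<close>.\<close>
      obtain B where B: "\<And>n. n \<ge> B \<Longrightarrow> n \<ge> M \<and> k n > i" using escape[of i] by blast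
      define n where "n = max B N'"
      have rn: "r n \<ge> M" "k (r n) > i" using B[of "r n"] seq_suble[OF r, of n] unfolding n_def by simp_all
      have "seg T (u (r N')) (u (r n)) = v ` {i\<^sub>0..k (r n)}"
        using seg_ray[OF \<open>inj v\<close> edge, of i\<^sub>0 "k (r n)"] k[OF rN'] k[OF rn(1)] rn(2) i
        unfolding i\<^sub>0_def by simp
      moreover have "u (r N') \<noteq> u (r n)"
        using k[OF rN'] k[OF rn(1)] rn(2) i \<open>inj v\<close> unfolding i\<^sub>0_def by (auto dest: injD)
      ultimately show ?thesis using N[of N' n "v i"] rn(2) i unfolding n_def N'_def by simp
    qed
    obtain B where B: "\<And>n. n \<ge> B \<Longrightarrow> n \<ge> M \<and> k n > i\<^sub>0" using escape[of i\<^sub>0] by blast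
    have "l z < e" if mn: "m \<ge> B" "n \<ge> B" and z: "z \<in> seg T (u m) (u n)" for m n z
    proof -
      have u: "u m = v (k m)" "u n = v (k n)" using k B mn by blast+
      have uV: "u m \<in> V" "u n \<in> V" using assms(3) by blast+
      have "seg T (u m) (u n) = v ` {min (k m) (k n)..max (k m) (k n)}"
      proof (cases "k m \<le> k n")
        case True
        then show ?thesis using seg_ray[OF \<open>inj v\<close> edge] u by simp
      next
        case False
        then show ?thesis using seg_ray[OF \<open>inj v\<close> edge, of "k n" "k m"] seg_commute[OF uV] u by simp
      qed
      then obtain i where i: "z = v i" "i \<ge> min (k m) (k n)" using z by auto
      have "i \<ge> i\<^sub>0" using i(2) B[OF mn(1)] B[OF mn(2)] by linarith
      then show ?thesis using small i(1) by blast
    qed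
    then show ?thesis by blast
  qed
  then show ?thesis unfolding MCauchy_label_dist_iff[OF l assms(3)] by blast
qed

end

section \<open>Labelings with a Cauchy subsequence\<close>

context rooted_tree
begin

text \<open>The combinatorial form of the failure of the Cauchy condition. The first property of \<open>A\<close> says
  that every enumeration of \<open>A\<close> stays eventually on one side of each edge, i.e. converges to a vertex
  or an end of \<open>T\<close>; the second one leaves room for infinitely many vertices of \<open>U\<close> outside the convex
  hull of \<open>A\<close>.\<close>

definition splits :: "'a set \<Rightarrow> bool" where
  "splits U \<longleftrightarrow> (\<exists>A \<subseteq> U. infinite A \<and>
     (\<forall>y \<in> V. finite {a \<in> A. y \<preceq> a} \<or> finite {a \<in> A. \<not> y \<preceq> a}) \<and>
     infinite (U - down_set A))"

text \<open>Labels measure how late a vertex leaves the paths between members of the tails of an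
  enumeration of \<open>A\<close>.\<close>

lemma non_Cauchy_labeling:
  assumes "inj u" "range u \<subseteq> V" "splits (range u)"
  shows "\<exists>l. nondegenerate_labeling T l \<and>
    (\<exists>r :: nat \<Rightarrow> nat. strict_mono r \<and> Metric_space.MCauchy V (label_dist T l) (u \<circ> r)) \<and>
    \<not> Metric_space.MCauchy V (label_dist T l) u"
proof -
  obtain A where A: "A \<subseteq> range u" "infinite A"
    and conv: "\<And>y. y \<in> V \<Longrightarrow> finite {a \<in> A. y \<preceq> a} \<or> finite {a \<in> A. \<not> y \<preceq> a}"
    and out: "infinite (range u - down_set A)"
    using assms(3) unfolding splits_def by blast
  have img: "u ` (u -` A) = A" using A(1) by blast
  then have inf: "infinite (u -` A)" using A(2) finite_imageI by metis
  define r where "r = enumerate (u -` A)"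
  have r: "strict_mono r" "range r = u -` A"
    unfolding r_def using strict_mono_enumerate[OF inf] range_enumerate[OF inf] by blast+
  define a where "a = u \<circ> r"
  have ra: "range a = A" unfolding a_def using img r(2) by (metis image_comp)
  have inja: "inj a" unfolding a_def
    using assms(1) strict_mono_imp_inj_on[OF r(1)] by (simp add: inj_compose)
  have aV: "a n \<in> V" for n using assms(2) by (auto simp: a_def)
  define K where "K N = (\<Union>j\<in>{N..}. \<Union>k\<in>{N..}. seg T (a j) (a k))" for N :: nat
  have K_anti: "K N \<subseteq> K M" if "M \<le> N" for M N
    using that unfolding K_def by fastforce
  \<comment> \<open>If the tail of \<open>a\<close> avoids the part above \<open>y\<close>, so do the paths between its members; if it is
    contained in that part, these paths stay there too and miss \<open>x\<close>.\<close>
  have no_cover: "\<exists>N. x \<notin> K N \<or> y \<notin> K N" if xy: "covers y x" for x y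
  proof -
    have y: "y \<in> V" "x \<preceq> y" "x \<noteq> y" using xy unfolding covers_def by blast+
    have tail: "\<exists>N. \<forall>n\<ge>N. \<not> P (a n)" if "finite {b \<in> A. P b}" for P
    proof -
      have "finite (a -` {b \<in> A. P b})" using that inja finite_vimageI by blast
      then obtain N where "\<And>n. n \<in> a -` {b \<in> A. P b} \<Longrightarrow> n < N"
        unfolding finite_nat_set_iff_bounded by blast
      then show ?thesis using ra by (intro exI[of _ N]) fastforce
    qed
    consider N where "\<forall>n\<ge>N. \<not> y \<preceq> a n" | N where "\<forall>n\<ge>N. y \<preceq> a n"
      using conv[OF y(1)] tail[of "\<lambda>b. y \<preceq> b"] tail[of "\<lambda>b. \<not> y \<preceq> b"] by blast
    then show ?thesis
    proof cases
      case 1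
      then have "y \<notin> K N" using below_of_seg[OF aV aV] unfolding K_def by fastforce
      then show ?thesis by blast
    next
      case 2
      have "\<not> y \<preceq> x" using below_antisym y by blast
      then have "x \<notin> K N" using above_convex[OF aV aV] 2 unfolding K_def by fastforce
      then show ?thesis by blast
    qed
  qed
  define l :: "'a \<Rightarrow> real" where
    "l x = (if \<forall>N. x \<in> K N then 0 else 1 / (1 + real (LEAST N. x \<notin> K N)))" for x
  have l_pos: "l x > 0" if "x \<notin> K N" for x N using that unfolding l_def by auto
  have l_nonneg: "l x \<ge> 0" for x unfolding l_def by simp
  have l_small: "l x \<le> 1 / (1 + real N)" if x: "x \<in> K N" for x N
  proof (cases "\<forall>N. x \<in> K N")
    case False
    then have "x \<notin> K (LEAST N. x \<notin> K N)" using LeastI_ex[of "\<lambda>N. x \<notin> K N"] by blast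
    then have "N \<le> (LEAST N. x \<notin> K N)" using K_anti x by (meson linear subsetD)
    then show ?thesis using False unfolding l_def by (simp add: frac_le)
  qed (simp add: l_def)
  have l_one: "l x = 1" if "x \<notin> K 0" for x
    using that unfolding l_def by (auto simp: Least_eq_0)
  have nondeg: "nondegenerate_labeling T l"
    unfolding nondegenerate_labeling_def
  proof (intro conjI ballI allI impI)
    fix x y assume e: "{x, y} \<in> edges T"
    have "covers y x \<or> covers x y"
      using edge_comparable[OF e root] edge_cover e by (metis insert_commute)
    then obtain N where "x \<notin> K N \<or> y \<notin> K N" using no_cover by blast
    then show "max (l x) (l y) > 0" using l_pos by (metis less_max_iff_disj)
  qed (rule l_nonneg)
  have "Metric_space.MCauchy V (label_dist T l) a"
  proof -
    have "\<exists>N. \<forall>m\<ge>N. \<forall>n\<ge>N. a m \<noteq> a n \<longrightarrow> (\<forall>z \<in> seg T (a m) (a n). l z < e)" if e: "e > 0" for e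
    proof -
      obtain N where N: "1 / (1 + real N) < e"
        using reals_Archimedean[OF e] by (auto simp: inverse_eq_divide)
      have "l z < e" if "m \<ge> N" "n \<ge> N" "z \<in> seg T (a m) (a n)" for m n z
        using l_small[of z N] N that unfolding K_def by fastforce
      then show ?thesis by blast
    qed
    then show ?thesis using MCauchy_label_dist_iff[OF nondeg, of a] aV by blast
  qed
  moreover have "\<not> Metric_space.MCauchy V (label_dist T l) u"
  proof
    assume "Metric_space.MCauchy V (label_dist T l) u"
    then obtain N where N: "\<And>m n z. \<lbrakk>m \<ge> N; n \<ge> N; u m \<noteq> u n; z \<in> seg T (u m) (u n)\<rbrakk> \<Longrightarrow> l z < 1"
      using MCauchy_label_dist_iff[OF nondeg assms(2)] zero_less_one by meson
    define S where "S = {n. u n \<notin> down_set A}"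
    have "range u - down_set A = u ` S" unfolding S_def by blast
    then have S: "infinite S" using out finite_imageI by metis
    obtain m where m: "m \<ge> N" "m \<in> S" using S unfolding infinite_nat_iff_unbounded_le by blast
    obtain n where n: "n > m" "n \<in> S" using S unfolding infinite_nat_iff_unbounded by blast
    have "K 0 \<subseteq> down_set A"
      using below_of_seg[OF aV aV] ra unfolding K_def down_set_def by blast
    then have "l (u m) = 1" using l_one m(2) unfolding S_def by blast
    moreover have "u m \<noteq> u n" using n assms(1) by (auto dest: injD)
    moreover have "u m \<in> seg T (u m) (u n)" using seg_basic assms(2) by blast
    ultimately show False using N[of m n "u m"] m n by simp
  qed
  ultimately show ?thesis using nondeg r(1) unfolding a_def by blast
qed

end

section \<open>Stars and combs\<close>

lemma infinite_split:
  assumes "infinite C"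
  obtains C\<^sub>1 C\<^sub>2 where "C\<^sub>1 \<subseteq> C" "C\<^sub>2 \<subseteq> C" "C\<^sub>1 \<inter> C\<^sub>2 = {}" "infinite C\<^sub>1" "infinite C\<^sub>2"
proof -
  obtain f :: "nat \<Rightarrow> 'a" where f: "inj f" "range f \<subseteq> C"
    using infinite_countable_subset[OF assms] by blast
  have "inj (\<lambda>n. f (2 * n))" "inj (\<lambda>n. f (2 * n + 1))"
    using inj_eq[OF f(1)] by (auto intro!: injI)
  then have "infinite (range (\<lambda>n. f (2 * n)))" "infinite (range (\<lambda>n. f (2 * n + 1)))"
    by (simp_all add: range_inj_infinite)
  moreover have "range (\<lambda>n. f (2 * n)) \<inter> range (\<lambda>n. f (2 * n + 1)) = {}"
  proof -
    have "f (2 * m) \<noteq> f (2 * n + 1)" for m n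
    proof
      assume "f (2 * m) = f (2 * n + 1)"
      then have "2 * m = 2 * n + 1" using inj_eq[OF f(1)] by blast
      then show False by presburger
    qed
    then show ?thesis by blast
  qed
  ultimately show thesis
    using that[of "range (\<lambda>n. f (2 * n))" "range (\<lambda>n. f (2 * n + 1))"] f(2) by blast
qed

context rooted_tree
begin

text \<open>Infinitely many covers \<open>c\<close> of \<open>w\<close> lie below a vertex \<open>f c\<close> of \<open>U\<close>, since each accounts for finitely
  many vertices of \<open>U\<close> only. Vertices above different covers are incomparable. Split the covers into
  two infinite parts and take the \<open>f c\<close> of one part as \<open>A\<close>; those of the other part are outside the
  down-set of \<open>A\<close>.\<close>

lemma splits_at_star:
  assumes U: "U \<subseteq> V" "infinite {a \<in> U. w \<preceq> a}"
    and fin: "\<And>c. covers c w \<Longrightarrow> finite {a \<in> U. c \<preceq> a}"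
  shows "splits U"
proof -
  define C where "C = {c. covers c w \<and> (\<exists>a \<in> U. c \<preceq> a)}"
  have "{a \<in> U. w \<preceq> a} \<subseteq> insert w (\<Union>c\<in>C. {a \<in> U. c \<preceq> a})"
  proof
    fix a assume a: "a \<in> {a \<in> U. w \<preceq> a}"
    show "a \<in> insert w (\<Union>c\<in>C. {a \<in> U. c \<preceq> a})"
    proof (cases "a = w")
      case False
      then obtain c where "covers c w" "c \<preceq> a" using cover_exists[of w a] a U(1) by blast
      then show ?thesis using a unfolding C_def by blast
    qed simp
  qed
  then have "infinite (insert w (\<Union>c\<in>C. {a \<in> U. c \<preceq> a}))" using U(2) finite_subset by blast
  then have "infinite C" using fin unfolding C_def by auto
  then obtain C\<^sub>1 C\<^sub>2 where C: "C\<^sub>1 \<subseteq> C" "C\<^sub>2 \<subseteq> C" "C\<^sub>1 \<inter> C\<^sub>2 = {}" "infinite C\<^sub>1" "infinite C\<^sub>2"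
    using infinite_split by metis
  have "\<forall>c \<in> C. \<exists>a. a \<in> U \<and> c \<preceq> a" unfolding C_def by blast
  then obtain f where f: "\<And>c. c \<in> C \<Longrightarrow> f c \<in> U \<and> c \<preceq> f c" by metis
  have fV: "f c \<in> V" if "c \<in> C" for c using f that U(1) by blast
  have same: "c = d" if "c \<in> C" "d \<in> C" "c \<preceq> f d" for c d
    using that f[of d] cover_unique[of c w d "f d"] fV unfolding C_def by blast
  have wf: "w \<preceq> f c" if "c \<in> C" for c
    using that f below_trans fV unfolding C_def covers_def by blast
  have inj: "inj_on f C" using f same by (metis inj_onI)
  define A where "A = f ` C\<^sub>1"
  have "infinite A" "infinite (f ` C\<^sub>2)"
    unfolding A_def using C inj finite_imageD inj_on_subset by metis+
  moreover have "A \<subseteq> U" unfolding A_def using f C by blast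
  moreover have "f ` C\<^sub>2 \<subseteq> U - down_set A"
  proof -
    have "\<not> f d \<preceq> f c" if cd: "c \<in> C\<^sub>1" "d \<in> C\<^sub>2" for c d
    proof
      assume "f d \<preceq> f c"
      then have "d \<preceq> f c" using below_trans f[of d] fV[of c] cd C by blast
      then show False using same[of d c] cd C by blast
    qed
    then show ?thesis using f C unfolding A_def down_set_def by blast
  qed
  moreover have "finite {a \<in> A. y \<preceq> a} \<or> finite {a \<in> A. \<not> y \<preceq> a}" if y: "y \<in> V" for y
  proof -
    consider "y \<preceq> w" | "w \<preceq> y" "w \<noteq> y" | "\<not> y \<preceq> w" "\<not> w \<preceq> y"
      using below_refl y by blast
    then show ?thesis
    proof cases
      case 1
      have "y \<preceq> a" if "a \<in> A" for a
        using that 1 wf below_trans fV C unfolding A_def by blast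
      then have "{a \<in> A. \<not> y \<preceq> a} = {}" by blast
      then show ?thesis by (metis finite.emptyI)
    next
      case 2
      obtain d where d: "covers d w" "d \<preceq> y" using cover_exists[OF 2 y] by blast
      have "c = d" if c: "c \<in> C" "y \<preceq> f c" for c
      proof -
        have "d \<preceq> f c" using below_trans d c fV by blast
        then show ?thesis using same[of d c] c d f unfolding C_def by blast
      qed
      then have "{a \<in> A. y \<preceq> a} \<subseteq> {f d}" using C unfolding A_def by blast
      then show ?thesis using finite_subset by blast
    next
      case 3
      have "\<not> y \<preceq> a" if "a \<in> A" for a
        using that 3 wf below_linear fV C unfolding A_def by blast
      then have "{a \<in> A. y \<preceq> a} = {}" by blast
      then show ?thesis by (metis finite.emptyI)
    qed
  qed
  ultimately show ?thesis unfolding splits_def by (meson finite_subset)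
qed

text \<open>The rays of \<open>T\<close> that start at the root, parametrized upwards.\<close>

definition rising :: "(nat \<Rightarrow> 'a) \<Rightarrow> bool" where
  "rising v \<longleftrightarrow> v 0 = p \<and> (\<forall>i. covers (v (Suc i)) (v i))"

lemma rising_in_V: "rising v \<Longrightarrow> v i \<in> V"
  using root unfolding rising_def covers_def by (cases i) auto

lemma rising_mono:
  assumes "rising v" "i \<le> j"
  shows "v i \<preceq> v j"
  using assms(2)
proof (induction j rule: dec_induct)
  case base
  then show ?case using below_refl rising_in_V assms(1) by blast
next
  case (step n)
  then show ?case using below_trans rising_in_V assms(1) unfolding rising_def covers_def by blast
qed

lemma rising_inj:
  assumes "rising v"
  shows "inj v"
proof (rule linorder_injI)
  fix i j :: nat assume "i < j"
  then have "v (Suc i) \<preceq> v j" using rising_mono assms by simp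
  moreover have "v i \<preceq> v (Suc i)" "v i \<noteq> v (Suc i)"
    using assms unfolding rising_def covers_def by blast+
  ultimately show "v i \<noteq> v j" using below_antisym rising_in_V assms by metis
qed

lemma below_rising:
  assumes "rising v" "x \<preceq> v i"
  shows "\<exists>j\<le>i. x = v j"
  using assms(2)
proof (induction i)
  case 0
  then have "x \<preceq> p" using assms(1) unfolding rising_def by simp
  then have "x = p" using seg_refl root by blast
  then show ?case using assms(1) unfolding rising_def by blast
next
  case (Suc i)
  have c: "covers (v (Suc i)) (v i)" using assms(1) unfolding rising_def by blast
  then have "x \<preceq> v i \<or> v i \<preceq> x"
    using below_linear[OF Suc.prems] unfolding covers_def by blast
  then show ?case
  proof
    assume "x \<preceq> v i"
    then show ?thesis using Suc.IH le_SucI by blast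
  next
    assume "v i \<preceq> x"
    then have "x = v i \<or> x = v (Suc i)" using c Suc.prems unfolding covers_def by blast
    then show ?thesis by (metis le_SucI order_refl)
  qed
qed

text \<open>The position at which the path from the root to \<open>z\<close> leaves the ray.\<close>

definition branch_index :: "(nat \<Rightarrow> 'a) \<Rightarrow> 'a \<Rightarrow> nat" where
  "branch_index v z = Max {i. v i \<preceq> z}"

lemma rising_below_iff:
  assumes v: "rising v" and z: "z \<in> V"
  shows "v i \<preceq> z \<longleftrightarrow> i \<le> branch_index v z"
proof -
  have "{i. v i \<preceq> z} = v -` seg T p z" by blast
  then have fin: "finite {i. v i \<preceq> z}"
    using finite_vimageI[OF seg_basic(1)[OF root z] rising_inj[OF v]] by simp
  have "0 \<in> {i. v i \<preceq> z}" using root_below z v unfolding rising_def by simp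
  then have "v (branch_index v z) \<preceq> z" using Max_in[OF fin] unfolding branch_index_def by blast
  then have "v i \<preceq> z" if "i \<le> branch_index v z"
    using rising_mono[OF v that] below_trans z by blast
  then show ?thesis using Max_ge[OF fin] unfolding branch_index_def by blast
qed

lemma branch_index_below:
  assumes v: "rising v" and "y \<preceq> z" "y \<notin> range v" "z \<in> V"
  shows "branch_index v y = branch_index v z"
proof (rule antisym)
  have y: "y \<in> V" using below_in_V assms by blast
  show "branch_index v y \<le> branch_index v z"
    using rising_below_iff[OF v] y assms below_trans by blast
  have "v (branch_index v z) \<preceq> z" using rising_below_iff[OF v \<open>z \<in> V\<close>] by blast
  moreover have "\<not> y \<preceq> v (branch_index v z)" using below_rising[OF v] assms(3) by blast
  ultimately have "v (branch_index v z) \<preceq> y" using below_linear assms by blast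
  then show "branch_index v z \<le> branch_index v y" using rising_below_iff[OF v y] by blast
qed

text \<open>If infinitely many vertices of \<open>U\<close> are on the ray, these form \<open>A\<close>, since nothing off the ray is
  below them. Otherwise infinitely many positions of the ray carry a branch with a vertex of \<open>U\<close>;
  choose one vertex for each such position and split the set of positions into two infinite parts,
  as for a star.\<close>

lemma splits_along_comb:
  assumes U: "U \<subseteq> V" and v: "rising v" and inf: "\<And>i. infinite {a \<in> U. v i \<preceq> a}"
    and off: "infinite (U - range v)"
  shows "splits U"
proof (cases "finite (U \<inter> range v)")
  case False
  define A where "A = U \<inter> range v"
  have down: "down_set A \<subseteq> range v"
    using below_rising[OF v] unfolding down_set_def A_def by blast
  have "finite {a \<in> A. y \<preceq> a} \<or> finite {a \<in> A. \<not> y \<preceq> a}" if y: "y \<in> V" for y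
  proof (cases "y \<in> range v")
    case True
    then obtain i where i: "y = v i" by blast
    have "{a \<in> A. \<not> y \<preceq> a} \<subseteq> v ` {..<i}"
      using rising_mono[OF v, of i] unfolding A_def i by (auto simp: not_less[symmetric])
    then show ?thesis using finite_subset by blast
  next
    case False
    then have "{a \<in> A. y \<preceq> a} = {}" using down unfolding down_set_def by blast
    then show ?thesis by (metis finite.emptyI)
  qed
  moreover have "infinite (U - down_set A)" using off down by (meson Diff_mono finite_subset order_refl)
  ultimately show ?thesis using False unfolding splits_def A_def by blast
next
  case True
  let ?b = "branch_index v"
  define J where "J = ?b ` (U - range v)"
  have "infinite J"
  proof
    assume "finite J"
    then obtain m where m: "\<And>a. a \<in> U - range v \<Longrightarrow> ?b a < m"
      unfolding finite_nat_set_iff_bounded J_def by blast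
    have "{a \<in> U. v m \<preceq> a} \<subseteq> U \<inter> range v"
    proof
      fix a assume a: "a \<in> {a \<in> U. v m \<preceq> a}"
      then have "m \<le> ?b a" using rising_below_iff[OF v] U by blast
      then show "a \<in> U \<inter> range v" using m[of a] a by fastforce
    qed
    then show False using inf[of m] True finite_subset by blast
  qed
  then obtain C\<^sub>1 C\<^sub>2 where C: "C\<^sub>1 \<subseteq> J" "C\<^sub>2 \<subseteq> J" "C\<^sub>1 \<inter> C\<^sub>2 = {}" "infinite C\<^sub>1" "infinite C\<^sub>2"
    using infinite_split by metis
  define f where "f = inv_into (U - range v) ?b"
  have f: "f c \<in> U" "f c \<notin> range v" "?b (f c) = c" if "c \<in> J" for c
    using inv_into_into[of c ?b "U - range v"] f_inv_into_f[of c ?b "U - range v"] that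
    unfolding f_def J_def by auto
  have inj: "inj_on f J" using f(3) by (metis inj_onI)
  have fV: "f c \<in> V" if "c \<in> J" for c using f that U by blast
  define A where "A = f ` C\<^sub>1"
  have "infinite A" "infinite (f ` C\<^sub>2)"
    unfolding A_def using C inj finite_imageD inj_on_subset by metis+
  moreover have "A \<subseteq> U" unfolding A_def using f C by blast
  moreover have "f ` C\<^sub>2 \<subseteq> U - down_set A"
  proof -
    have "\<not> f d \<preceq> f c" if cd: "c \<in> C\<^sub>1" "d \<in> C\<^sub>2" for c d
    proof
      assume "f d \<preceq> f c"
      then have "d = c" using branch_index_below[OF v, of "f d" "f c"] f fV cd C by (metis subsetD)
      then show False using cd C by blast
    qed
    then show ?thesis using f C unfolding A_def down_set_def by blast
  qed
  moreover have "finite {a \<in> A. y \<preceq> a} \<or> finite {a \<in> A. \<not> y \<preceq> a}" if y: "y \<in> V" for y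
  proof (cases "y \<in> range v")
    case True
    then obtain i where i: "y = v i" by blast
    have "c < i" if "c \<in> J" "\<not> v i \<preceq> f c" for c
      using that rising_below_iff[OF v fV, of c i] f by simp
    then have "{a \<in> A. \<not> y \<preceq> a} \<subseteq> f ` {..<i}" using C unfolding A_def i by blast
    then show ?thesis using finite_subset by blast
  next
    case False
    have "c = ?b y" if "c \<in> J" "y \<preceq> f c" for c
      using branch_index_below[OF v that(2) False fV] that f by simp
    then have "{a \<in> A. y \<preceq> a} \<subseteq> {f (?b y)}" using C unfolding A_def by blast
    then show ?thesis using finite_subset by blast
  qed
  ultimately show ?thesis unfolding splits_def by (meson finite_subset)
qed

text \<open>Start at the root and pass again and again to a cover with infinitely many vertices of \<open>U\<close>
  above it. The climb gets stuck only at a star, which is excluded.\<close>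

lemma splits_or_ray:
  assumes U: "U \<subseteq> V" "infinite U" and "\<not> splits U"
  obtains v where "rising v" "\<And>i. infinite {a \<in> U. v i \<preceq> a}" "finite (U - range v)"
proof -
  let ?P = "\<lambda>n x. x \<in> V \<and> infinite {a \<in> U. x \<preceq> a} \<and> (n = (0::nat) \<longrightarrow> x = p)"
  have "{a \<in> U. p \<preceq> a} = U" using root_below U by blast
  then have "\<exists>x. ?P 0 x" using root U by auto
  moreover have "\<exists>y. ?P (Suc n) y \<and> covers y x" if x: "?P n x" for x n
    using splits_at_star[OF U(1), of x] assms(3) x unfolding covers_def by blast
  ultimately obtain v where v: "\<And>n. ?P n (v n) \<and> covers (v (Suc n)) (v n)"
    using dependent_nat_choice[of ?P "\<lambda>n x y. covers y x"] by blast
  then have "rising v" unfolding rising_def by blast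
  then show thesis using that[of v] splits_along_comb[OF U(1), of v] v assms(3) by blast
qed

text \<open>The finite part \<open>T\<^sub>0\<close> is spanned by the root and the vertices of \<open>U\<close> off the ray. An edge of the
  hull is named by its upper end: if that is on the ray, the edge belongs to the ray, and otherwise
  both ends are below a vertex of \<open>U\<close> off the ray.\<close>

lemma almost_ray_hull:
  assumes U: "U \<subseteq> V" "infinite U" "p \<in> U" and v: "rising v"
    and inf: "\<And>i. infinite {a \<in> U. v i \<preceq> a}" and fin: "finite (U - range v)"
  shows "almost_ray (tree_hull T U)"
proof -
  define F where "F = insert p (U - range v)"
  let ?H = "induced_graph T (down_set U)" and ?T\<^sub>0 = "induced_graph T (down_set F)"
  let ?R = "\<lparr>verts = range v, edges = range (\<lambda>n. {v n, v (Suc n)})\<rparr>"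
  have F: "F \<subseteq> U" "finite F" "F \<noteq> {}" unfolding F_def using U fin by auto
  have FV: "F \<subseteq> V" using F U by blast
  have cov: "covers (v (Suc n)) (v n)" for n using v unfolding rising_def by blast
  have edge: "{v n, v (Suc n)} \<in> edges T" for n using cover_edge cov by blast
  have vU: "range v \<subseteq> down_set U"
  proof -
    have "\<exists>a \<in> U. v i \<preceq> a" for i
    proof -
      have "{a \<in> U. v i \<preceq> a} \<noteq> {}" using inf[of i] by (metis finite.emptyI)
      then show ?thesis by blast
    qed
    then show ?thesis unfolding down_set_def by blast
  qed
  \<comment> \<open>Everything below a vertex of the ray is on the ray.\<close>
  have off: "a \<in> F" if "a \<in> U" "x \<preceq> a" "x \<notin> range v" for a x
    using that below_rising[OF v] unfolding F_def by blast
  have H: "is_tree ?H" using subtree_down_set[of U] U unfolding subtree_def by blast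
  have T\<^sub>0: "subtree ?T\<^sub>0 T" using subtree_down_set FV F by blast
  have "down_set F \<subseteq> down_set U" using F unfolding down_set_def by blast
  then have sub: "subtree ?T\<^sub>0 ?H"
    using T\<^sub>0 unfolding subtree_def subgraph_def by (auto simp: induced_graph_def)
  have "down_set F = (\<Union>a\<in>F. {x. x \<preceq> a})" unfolding down_set_def by blast
  then have finT: "finite (verts ?T\<^sub>0)"
    using F(2) finite_below FV by (auto simp: induced_graph_def)
  have "v n \<noteq> v (Suc n)" for n using cov unfolding covers_def by blast
  then have simple: "simple_graph ?R" unfolding simple_graph_def by fastforce
  have R: "subgraph ?R ?H" using simple vU edge unfolding subgraph_def
    by (auto simp: induced_graph_def)
  have verts: "down_set U = down_set F \<union> range v"
    using off vU \<open>down_set F \<subseteq> down_set U\<close> unfolding down_set_def by blast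
  have edges_R: "{x, y} \<in> edges ?T\<^sub>0 \<union> edges ?R"
    if xy: "covers y x" "{x, y} \<in> edges T" "y \<in> down_set U" for x y
  proof (cases "y \<in> range v")
    case True
    then obtain i where i: "y = v i" by blast
    then obtain j where j: "j \<le> i" "x = v j"
      using below_rising[OF v] xy(1) unfolding covers_def by blast
    have ji: "Suc j \<le> i" using j i xy(1) unfolding covers_def by (metis le_neq_implies_less Suc_leI)
    then have "v (Suc j) = v j \<or> v (Suc j) = v i"
      using rising_mono[OF v, of j "Suc j"] rising_mono[OF v ji] xy(1) unfolding covers_def i j(2)
      by (metis le_SucI order_refl)
    then have "Suc j = i" using rising_inj[OF v] by (metis injD n_not_Suc_n)
    then show ?thesis using i j by auto
  next
    case False
    obtain a where a: "a \<in> U" "y \<preceq> a" using xy(3) unfolding down_set_def by blast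
    have "a \<in> F" using off a False by blast
    moreover have "x \<preceq> a" using below_trans xy(1) a U unfolding covers_def by blast
    ultimately have "x \<in> down_set F" "y \<in> down_set F" using a unfolding down_set_def by blast+
    then show ?thesis using xy(2) by (simp add: induced_graph_def)
  qed
  have "edges ?H \<subseteq> edges ?T\<^sub>0 \<union> edges ?R"
  proof
    fix e assume "e \<in> edges ?H"
    then have e: "e \<in> edges T" "e \<subseteq> down_set U" by (auto simp: induced_graph_def)
    obtain x y where xy: "e = {x, y}" using edge_ends e(1) by metis
    have "covers y x \<or> covers x y"
      using edge_comparable[OF _ root, of x y] edge_cover e(1) xy by (metis insert_commute)
    then show "e \<in> edges ?T\<^sub>0 \<union> edges ?R"
      using edges_R[of y x] edges_R[of x y] e by (auto simp: xy insert_commute)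
  qed
  then have "edges ?H = edges ?T\<^sub>0 \<union> edges ?R"
    using sub R unfolding subtree_def subgraph_def by blast
  then have "?H = graph_union ?T\<^sub>0 ?R"
    using verts unfolding graph_union_def
    by (intro ugraph.equality) (simp_all add: induced_graph_def)
  moreover have "is_ray ?R" unfolding is_ray_def using rising_inj[OF v] by blast
  moreover have "infinite (verts ?H)"
    using subset_down_set[OF U(1)] U(2) finite_subset by (auto simp: induced_graph_def)
  ultimately have "almost_ray ?H" unfolding almost_ray_def using H R sub finT by blast
  then show ?thesis using tree_hull_eq_down_set U by simp
qed

end

theorem theorem4p1:
  fixes T :: "'a ugraph" and u :: "nat \<Rightarrow> 'a"
  assumes "is_tree T"
    and "inj u"
    and "range u \<subseteq> verts T"
  shows "almost_ray (tree_hull T (range u)) \<longleftrightarrow>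
    (\<forall>l :: 'a \<Rightarrow> real. nondegenerate_labeling T l \<longrightarrow>
       (\<exists>r :: nat \<Rightarrow> nat. strict_mono r \<and>
          Metric_space.MCauchy (verts T) (label_dist T l) (u \<circ> r)) \<longrightarrow>
       Metric_space.MCauchy (verts T) (label_dist T l) u)"
    (is "?ray \<longleftrightarrow> ?cauchy")
proof -
  interpret rooted_tree T "u 0" using assms by unfold_locales auto
  have hull: "tree_hull T (range u) = induced_graph T (down_set (range u))"
    using tree_hull_eq_down_set assms(3) by blast
  show ?thesis
  proof
    assume ?ray
    then obtain R T\<^sub>0 where R: "is_ray R" "subgraph R (tree_hull T (range u))"
      and T\<^sub>0: "finite (verts T\<^sub>0)" and union: "tree_hull T (range u) = graph_union T\<^sub>0 R"
      unfolding almost_ray_def by blast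
    obtain v :: "nat \<Rightarrow> 'a" where v: "inj v"
      and Rv: "R = \<lparr>verts = range v, edges = range (\<lambda>n. {v n, v (Suc n)})\<rparr>"
      using R(1) unfolding is_ray_def by blast
    have edge: "{v n, v (Suc n)} \<in> edges T" for n
      using R(2) unfolding subgraph_def Rv hull induced_graph_def by auto
    have "range u \<subseteq> verts (tree_hull T (range u))"
      using subset_down_set[OF assms(3)] unfolding hull induced_graph_def by simp
    then have "range u \<subseteq> verts T\<^sub>0 \<union> range v" unfolding union graph_union_def Rv by simp
    then show ?cauchy using MCauchy_along_ray[OF _ assms(2,3) T\<^sub>0 _ v edge] by blast
  next
    assume ?cauchy
    then have "\<not> splits (range u)" using non_Cauchy_labeling[OF assms(2,3)] by blast
    then obtain v where "rising v" "\<And>i. infinite {a \<in> range u. v i \<in> seg T (u 0) a}"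
        "finite (range u - range v)"
      using splits_or_ray assms(2,3) range_inj_infinite by blast
    then show ?ray using almost_ray_hull assms(2,3) range_inj_infinite by blast
  qed
qed

end
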